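(* Let $\alpha\in(0,1)$. Let the single observation $\boldsymbol{X}$ and the parameter $\boldsymbol{\theta}$ both belong to a Banach space $\mathbb{B}$ of possibly infinite dimension, let the null hypothesis be $H_0\colon\boldsymbol{\theta}\in\Theta_0$ for a subset $\Theta_0\subset\mathbb{B}$ (no restriction on its shape), with alternative $\boldsymbol{\theta}\notin\Theta_0$, and consider the Bayesian test that rejects $H_0$ if and only if $\mathrm{P}(\boldsymbol{\theta}\in\Theta_0\mid\boldsymbol{X})\le\alpha$. Say that a functional $\phi\colon\mathbb{B}\to\mathbb{R}$ satisfies condition (A) if $\phi$ is a continuous linear functional and there is a continuous CDF $F(\cdot)$ with support $\mathbb{R}$ and symmetry $F(-x)=1-F(x)$ such that the sampling distribution satisfies $\phi(\boldsymbol{X})-\phi(\boldsymbol{\theta})\mid\boldsymbol{\theta}\sim F$ and the posterior satisfies $\phi(\boldsymbol{\theta})-\phi(\boldsymbol{X})\mid\boldsymbol{X}\sim F$, for every $\boldsymbol{\theta}$ and every $\boldsymbol{X}$ in $\mathbb{B}$. (i) For any $\phi$ satisfying (A), if there exists $c_0\in\mathbb{R}$ such that $\Theta_0=\{\boldsymbol{\theta}:\phi(\boldsymbol{\theta})\le c_0\}$, then the Bayesian test's size is $\alpha$, and its type I error rate is $\alpha$ when $\phi(\boldsymbol{\theta})=c_0$. (ii) For any $\phi$ satisfying (A), if there exists $c_0\in\mathbb{R}$ such that $\Theta_0\subseteq\{\boldsymbol{\theta}:\phi(\boldsymbol{\theta})\le c_0\}$ with $c_0\in\phi(\overline{\Theta_0})$,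 then the Bayesian test's size is $\alpha$ or greater. (iii) Let $\phi$ and $c_0$ be as in (ii), i.e. $\phi$ satisfies (A), $\Theta_0\subseteq\{\boldsymbol{\theta}:\phi(\boldsymbol{\theta})\le c_0\}$ and $c_0\in\phi(\overline{\Theta_0})$. Assume further that there exist $\phi_2\colon\mathbb{B}\to\mathbb{R}^d$ and a distribution $F_2$ on $\mathbb{R}^d$ with $\phi_2(\boldsymbol{X})-\phi_2(\boldsymbol{\theta})\mid\boldsymbol{\theta}\sim F_2$ and $\phi_2(\boldsymbol{\theta})-\phi_2(\boldsymbol{X})\mid\boldsymbol{X}\sim F_2$ for every $\boldsymbol{\theta}$ and $\boldsymbol{X}$, and that $\phi(\cdot)=\phi_3(\phi_2(\cdot))$ for some projection $\phi_3\colon\mathbb{R}^d\to\mathbb{R}$. Let $\Phi_2\equiv\{\phi_2(\boldsymbol{\theta}):\boldsymbol{\theta}\in\Theta_0\}$ and assume $\Phi_2\subset\{\phi_2(\boldsymbol{\theta}):\phi(\boldsymbol{\theta})\le c_0\}$ (proper subset). Assume also: (a) the set $\Delta\equiv\{\boldsymbol{p}\in\mathbb{R}^d:\phi_3(\boldsymbol{p})\le c_0,\ \boldsymbol{p}\notin\Phi_2\}$ has positive Lebesgue measure; (b) $F_2$ has a strictly positive PDF over $\mathbb{R}^d$; (c) $\mathrm{P}(\phi_2(\boldsymbol{\theta})\in\Phi_2\mid\phi_2(\boldsymbol{X}))$ is continuous in $\phi_2(\boldsymbol{X})$. Then the Bayesian test's rejection probability is strictly above $\alpha$ when $\phi(\boldsymbol{\theta})=c_0$,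 and its size is strictly above $\alpha$. If $\mathbb{B}=\mathbb{R}^d$, one takes $\phi_2(\boldsymbol{\theta})=\boldsymbol{\theta}$, $\phi_3=\phi$ and $\Phi_2=\Theta_0$, and the rejection probability is strictly above $\alpha$ for any $\boldsymbol{\theta}$ that is a support point of $\overline{\Theta_0}$ (with supporting functional $\phi$ and value $c_0=\phi(\boldsymbol{\theta})$ for which $\phi$ satisfies (A), $\Theta_0$ is a proper subset of $\{\boldsymbol{t}\in\mathbb{R}^d:\phi(\boldsymbol{t})\le c_0\}$, $\boldsymbol{X}-\boldsymbol{\theta}\mid\boldsymbol{\theta}\sim F_2$ and $\boldsymbol{\theta}-\boldsymbol{X}\mid\boldsymbol{X}\sim F_2$ for every $\boldsymbol{\theta}$ and $\boldsymbol{X}$, and (a), (b), (c) hold with these choices of $\phi_2$, $\phi_3$ and $\Phi_2$). (iv) If, contrary to (ii), there do not exist any (nonzero) continuous linear functional $\phi$ and $c_0\in\mathbb{R}$ such that $\Theta_0\subseteq\{\boldsymbol{\theta}:\phi(\boldsymbol{\theta})\le c_0\}$ (i.e. $\Theta_0$ is not a subset of a half-space), then the Bayesian test's size may be greater than, equal to, or less than $\alpha$, and it may depend on the sampling/posterior distribution in addition to the shape of $\Theta_0$. That is: among settings consisting of a Banach space $\mathbb{B}$, a subset $\Theta_0\subset\mathbb{B}$, and sampling and posterior distributions for $\boldsymbol{X},\boldsymbol{\theta}\in\mathbb{B}$ (with some functional satisfying (A)) in which $\Theta_0$ is not a subset of a half-space, there exist settings in which the size is strictly greater than $\alpha$, settings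 in which it equals $\alpha$, and settings in which it is strictly less than $\alpha$; and there exists such a $\Theta_0$ for which the size differs between two different choices of the sampling/posterior distributions. (v) Let $\phi$ satisfy (A) and let $c_0\in\mathbb{R}$. Let $\phi_2\colon\mathbb{B}\to\mathbb{R}^d$ and $F_2$ satisfy $\phi_2(\boldsymbol{X})-\phi_2(\boldsymbol{\theta})\mid\boldsymbol{\theta}\sim F_2$ and $\phi_2(\boldsymbol{\theta})-\phi_2(\boldsymbol{X})\mid\boldsymbol{X}\sim F_2$ for every $\boldsymbol{\theta}$ and $\boldsymbol{X}$, with $\phi(\cdot)=\phi_3(\phi_2(\cdot))$ for some projection $\phi_3\colon\mathbb{R}^d\to\mathbb{R}$. Let now $\Phi_2\equiv\{\phi_2(\boldsymbol{\theta}):\boldsymbol{\theta}\notin\Theta_0\}^{\complement}$ (complement in $\mathbb{R}^d$) and assume $\Phi_2\supset\{\phi_2(\boldsymbol{\theta}):\phi(\boldsymbol{\theta})\le c_0\}$ (proper superset). Assume that $\Delta\equiv\{\boldsymbol{p}:\boldsymbol{p}\in\Phi_2,\ \phi_3(\boldsymbol{p})>c_0\}$ has positive Lebesgue measure, that $F_2$ has a strictly positive PDF over $\mathbb{R}^d$, and that $\mathrm{P}(\phi_2(\boldsymbol{\theta})\in\Phi_2\mid\phi_2(\boldsymbol{X}))$ is continuous in $\phi_2(\boldsymbol{X})$. Then the Bayesian test's rejection probability is strictly below $\alpha$ when $\phi(\boldsymbol{\theta})=c_0$. If $\mathbb{B}=\mathbb{R}^d$ (with $\phi_2(\boldsymbol{\theta})=\boldsymbol{\theta}$,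 $\phi_3=\phi$, $\Phi_2=\Theta_0$), this implies that the rejection probability is strictly below $\alpha$ for any $\boldsymbol{\theta}$ that is a support point of $\overline{\Theta_0^{\complement}}$, the closure of the complement of $\Theta_0$ (with supporting hyperplane $\{\phi=c_0\}$, $c_0=\phi(\boldsymbol{\theta})$, $\Theta_0^\complement\subseteq\{\phi\ge c_0\}$, for which $\phi$ satisfies (A), $\boldsymbol{X}-\boldsymbol{\theta}\mid\boldsymbol{\theta}\sim F_2$ and $\boldsymbol{\theta}-\boldsymbol{X}\mid\boldsymbol{X}\sim F_2$ for every $\boldsymbol{\theta}$ and $\boldsymbol{X}$ with $F_2$ having a strictly positive PDF over $\mathbb{R}^d$, $\Theta_0$ is a proper superset of $\{\boldsymbol{t}\in\mathbb{R}^d:\phi(\boldsymbol{t})\le c_0\}$, the set $\{\boldsymbol{p}\in\Theta_0:\phi(\boldsymbol{p})>c_0\}$ has positive Lebesgue measure, and $\mathrm{P}(\boldsymbol{\theta}\in\Theta_0\mid\boldsymbol{X})$ is continuous in $\boldsymbol{X}$).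
   Context: The sampling distribution is a family of probability laws for $\boldsymbol{X}$ indexed by the fixed parameter value $\boldsymbol{\theta}\in\mathbb{B}$ (notation $\mid\boldsymbol{\theta}$); the posterior is a family of probability laws for $\boldsymbol{\theta}$ indexed by the observed value $\boldsymbol{X}\in\mathbb{B}$ (notation $\mid\boldsymbol{X}$). The two families are given directly; they need not come from a proper prior (an improper flat prior is implicitly allowed). All probabilities that appear are assumed well-defined. The rejection probability at $\boldsymbol{\theta}$ is the probability, under the sampling distribution given $\boldsymbol{\theta}$, that the test rejects, i.e. that $\boldsymbol{X}$ lies in the rejection region $\{\boldsymbol{x}:\mathrm{P}(\boldsymbol{\theta}\in\Theta_0\mid\boldsymbol{X}=\boldsymbol{x})\le\alpha\}$. For $\boldsymbol{\theta}\in\Theta_0$ the rejection probability is called the type I error rate at $\boldsymbol{\theta}$. The size of the test is the supremum of the rejection probability over $\boldsymbol{\theta}\in\Theta_0$. $\overline{A}$ denotes the closure of $A$ and $A^\complement$ the complement of $A$. A half-space is a set $\{\boldsymbol{\theta}:\phi(\boldsymbol{\theta})\le c_0\}$ with $\phi$ a nonzero continuous linear functional and $c_0\in\mathbb{R}$. A support point of a closed set $C$ is a point $\boldsymbol{\theta}\in C$ lying on a supporting hyperplane $\{\phi=c_0\}$ of $C$, i.e. $\phi(\boldsymbol{\theta})=c_0$ and $C$ lies entirely on one side of the hyperplane.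
   Formalization: In (iii), the claim that the size is strictly above α is proved under the added assumption that φ_2 is continuous; without it the claim can fail when c_0 is approached but not attained on Θ_0. The rejection-probability claim needs no such assumption. *)

theory Defs
  imports "HOL-Probability.Probability"
begin

(* Probability laws on the whole type, indexed by a fixed value. The sigma-algebra is left
   open: in an infinite-dimensional space it may, for example, be the cylindrical one. *)
definition law_family :: "('a \<Rightarrow> 'a measure) \<Rightarrow> bool" where
  "law_family K \<longleftrightarrow> (\<forall>t. prob_space (K t) \<and> space (K t) = UNIV)"

(* Q x is the posterior law of the parameter given the observation x. *)
definition rejection_region :: "real \<Rightarrow> ('a \<Rightarrow> 'a measure) \<Rightarrow> 'a set \<Rightarrow> 'a set" where
  "rejection_region \<alpha> Q \<Theta>0 = {x. measure (Q x) \<Theta>0 \<le> \<alpha>}"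

(* S \<theta> is the sampling law of the observation given the parameter \<theta>.
   For \<theta> in \<Theta>0 this is the type I error rate at \<theta>. *)
definition rejection_prob ::
    "real \<Rightarrow> ('a \<Rightarrow> 'a measure) \<Rightarrow> ('a \<Rightarrow> 'a measure) \<Rightarrow> 'a set \<Rightarrow> 'a \<Rightarrow> real" where
  "rejection_prob \<alpha> S Q \<Theta>0 \<theta> = measure (S \<theta>) (rejection_region \<alpha> Q \<Theta>0)"

definition test_size ::
    "real \<Rightarrow> ('a \<Rightarrow> 'a measure) \<Rightarrow> ('a \<Rightarrow> 'a measure) \<Rightarrow> 'a set \<Rightarrow> real" where
  "test_size \<alpha> S Q \<Theta>0 = (SUP \<theta>\<in>\<Theta>0. rejection_prob \<alpha> S Q \<Theta>0 \<theta>)"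

(* The measurability conditions say that the posterior probability of \<Theta>0 and the rejection
   probabilities are well-defined: the value 0 that measure assigns to a non-measurable set
   never enters. S and Q are not linked through a prior. *)
definition bayes_test ::
    "real \<Rightarrow> ('a \<Rightarrow> 'a measure) \<Rightarrow> ('a \<Rightarrow> 'a measure) \<Rightarrow> 'a set \<Rightarrow> bool" where
  "bayes_test \<alpha> S Q \<Theta>0 \<longleftrightarrow>
     law_family S \<and> law_family Q \<and>
     (\<forall>x. \<Theta>0 \<in> sets (Q x)) \<and>
     (\<forall>\<theta>. rejection_region \<alpha> Q \<Theta>0 \<in> sets (S \<theta>))"

definition has_law :: "'a measure \<Rightarrow> ('a \<Rightarrow> 'b::topological_space) \<Rightarrow> 'b measure \<Rightarrow> bool" where
  "has_law M T F \<longleftrightarrow> T \<in> borel_measurable M \<and> distr M borel T = F"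

(* T(X) - T(\<theta>) | \<theta> ~ F  and  T(\<theta>) - T(X) | X ~ F, for all \<theta> and X *)
definition location_model ::
    "('a \<Rightarrow> 'a measure) \<Rightarrow> ('a \<Rightarrow> 'a measure) \<Rightarrow> ('a \<Rightarrow> 'b::real_normed_vector) \<Rightarrow> 'b measure \<Rightarrow> bool" where
  "location_model S Q T F \<longleftrightarrow>
     (\<forall>\<theta>. has_law (S \<theta>) (\<lambda>x. T x - T \<theta>) F) \<and>
     (\<forall>x. has_law (Q x) (\<lambda>\<theta>. T \<theta> - T x) F)"

definition measure_support :: "'a::topological_space measure \<Rightarrow> 'a set" where
  "measure_support M = {x. \<forall>U. open U \<and> x \<in> U \<longrightarrow> emeasure M U > 0}"

definition condition_A ::
    "('a::real_normed_vector \<Rightarrow> 'a measure) \<Rightarrow> ('a \<Rightarrow> 'a measure) \<Rightarrow> ('a \<Rightarrow> real) \<Rightarrow> bool" where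
  "condition_A S Q \<phi> \<longleftrightarrow>
     bounded_linear \<phi> \<and>
     (\<exists>F. real_distribution F \<and> continuous_on UNIV (cdf F) \<and> measure_support F = UNIV \<and>
          (\<forall>x. cdf F (- x) = 1 - cdf F x) \<and>
          location_model S Q \<phi> F)"

definition has_positive_pdf :: "(real ^ 'd) measure \<Rightarrow> bool" where
  "has_positive_pdf F \<longleftrightarrow>
     (\<exists>f. f \<in> borel_measurable borel \<and> (\<forall>p. 0 < f p) \<and> F = density lborel (\<lambda>p. ennreal (f p)))"

(* P(T(\<theta>) \<in> B | T(X)) is well-defined and continuous in T(X): the posterior probability of
   {T \<in> B} depends on the observation x through T x only, and does so continuously. *)
definition posterior_prob_continuous ::
    "('a \<Rightarrow> 'a measure) \<Rightarrow> ('a \<Rightarrow> 'b::topological_space) \<Rightarrow> 'b set \<Rightarrow> bool" where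
  "posterior_prob_continuous Q T B \<longleftrightarrow>
     (\<forall>x. {\<theta>. T \<theta> \<in> B} \<in> sets (Q x)) \<and>
     (\<exists>g::'b \<Rightarrow> real. continuous_on (range T) g \<and> (\<forall>x. measure (Q x) {\<theta>. T \<theta> \<in> B} = g (T x)))"

(* \<theta> is a support point of C, on the supporting hyperplane {\<phi> = c} *)
definition support_point_at ::
    "'a::real_normed_vector set \<Rightarrow> ('a \<Rightarrow> real) \<Rightarrow> real \<Rightarrow> 'a \<Rightarrow> bool" where
  "support_point_at C \<phi> c \<theta> \<longleftrightarrow>
     bounded_linear \<phi> \<and> \<phi> \<noteq> (\<lambda>_. 0) \<and> \<theta> \<in> C \<and> \<phi> \<theta> = c \<and>
     (C \<subseteq> {t. \<phi> t \<le> c} \<or> C \<subseteq> {t. c \<le> \<phi> t})"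

definition within_half_space :: "'a::real_normed_vector set \<Rightarrow> bool" where
  "within_half_space A \<longleftrightarrow>
     (\<exists>(\<phi> :: 'a \<Rightarrow> real) c. bounded_linear \<phi> \<and> \<phi> \<noteq> (\<lambda>_. 0) \<and> A \<subseteq> {\<theta>. \<phi> \<theta> \<le> c})"

(* The strict inclusion excludes \<Theta>0 = UNIV, whose test never rejects. *)
definition non_half_space_setting ::
    "real \<Rightarrow> ('a::real_normed_vector \<Rightarrow> 'a measure) \<Rightarrow> ('a \<Rightarrow> 'a measure) \<Rightarrow> 'a set \<Rightarrow> bool" where
  "non_half_space_setting \<alpha> S Q \<Theta>0 \<longleftrightarrow>
     bayes_test \<alpha> S Q \<Theta>0 \<and>
     (\<forall>t. sets (S t) = sets borel \<and> sets (Q t) = sets borel) \<and>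
     (\<exists>\<phi>. condition_A S Q \<phi>) \<and>
     \<Theta>0 \<subset> UNIV \<and> \<not> within_half_space \<Theta>0"

end

theory Submission
  imports Defs
begin

text \<open>
  Along a functional \<open>\<phi>\<close> satisfying condition (A) the problem is one-dimensional and symmetric.
  Let \<open>z\<close> be the \<open>\<alpha>\<close>-quantile of \<open>F\<close>. The posterior probability of a half-space
  \<open>{\<phi> \<le> c}\<close> is \<open>F (c - \<phi> x)\<close>, which is at most \<open>\<alpha>\<close> exactly when \<open>\<phi> x \<ge> c - z\<close>; by symmetry of \<open>F\<close>
  the sampling law gives that event the probability \<open>F (z + \<phi> \<theta> - c)\<close>. This is \<open>\<alpha>\<close> on the
  hyperplane \<open>\<phi> \<theta> = c\<close> and smaller below it, which settles half-spaces (\<open>half_space_size\<close>). A smaller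
  null hypothesis has smaller posterior probability, so the test rejects at least on
  \<open>{\<phi> \<ge> c - z}\<close>; letting \<open>\<theta>\<close> approach the hyperplane within the null hypothesis bounds the size
  below by \<open>\<alpha>\<close> (\<open>size_ge_if_subset_half_space\<close>).

  For the strict inequalities, the set \<open>\<Delta>\<close> by which the null hypothesis differs from the half-space
  has positive probability under every translate of \<open>F2\<close>. Hence the posterior probability of the
  null hypothesis differs strictly from \<open>\<alpha>\<close> already on the critical hyperplane \<open>\<phi> x = c - z\<close>. By
  continuity this persists on a neighbourhood of a point of that hyperplane, and the part of it on
  the side where the half-space test decides otherwise is a nonempty open set \<open>V\<close> of outcomes whose
  verdict is changed. The sampling
  law gives \<open>V\<close> positive probability, so the rejection probability moves strictly away from \<open>\<alpha>\<close>
  (\<open>rejection_prob_lower_bound\<close>, \<open>rejection_prob_less_on_hyperplane\<close>).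

  Outside half-spaces, normal laws concentrated on horizontal lines of the plane give all
  three cases. Each posterior sees only one horizontal slice of the null hypothesis, so
  its slice on a single line, and the lines that carry the laws, decide the size, while the other, full lines keep
  the set from fitting into a half-space (\<open>off_axis_not_within_half_space\<close>).
\<close>

section \<open>Laws of a statistic in a location model\<close>

text \<open>The sampling law and the posterior of a location model have the same form, so each fact
  is stated once, for a single family \<open>K\<close> of laws.\<close>

lemma location_preimage:
  fixes T :: "'a \<Rightarrow> 'b::real_normed_vector"
  assumes "law_family K" and "\<And>t. has_law (K t) (\<lambda>s. T s - T t) F" and A: "A \<in> sets borel"
  shows "{s. T s \<in> A} \<in> sets (K t)"
    and "measure (K t) {s. T s \<in> A} = measure F {v. T t + v \<in> A}"
proof -
  have sp: "space (K t) = UNIV" using assms(1) by (simp add: law_family_def)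
  have m: "(\<lambda>s. T s - T t) \<in> borel_measurable (K t)" and F: "F = distr (K t) borel (\<lambda>s. T s - T t)"
    using assms(2)[of t] by (auto simp: has_law_def)
  have "(\<lambda>v. T t + v) \<in> borel_measurable borel"
    by (intro borel_measurable_continuous_onI continuous_intros)
  from measurable_sets[OF this A] have B: "{v. T t + v \<in> A} \<in> sets borel"
    by (simp add: vimage_def)
  have eq: "(\<lambda>s. T s - T t) -` {v. T t + v \<in> A} \<inter> space (K t) = {s. T s \<in> A}"
    using sp by auto
  show "{s. T s \<in> A} \<in> sets (K t)"
    using measurable_sets[OF m B] eq by simp
  show "measure (K t) {s. T s \<in> A} = measure F {v. T t + v \<in> A}"
    unfolding F using measure_distr[OF m, of "{v. T t + v \<in> A}"] B eq by simp
qed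

lemma location_model_prob_space:
  assumes "law_family S" and "location_model S Q T F"
  shows "prob_space F"
proof -
  fix t
  have "F = distr (S t) borel (\<lambda>s. T s - T t)" "(\<lambda>s. T s - T t) \<in> borel_measurable (S t)"
    using assms(2) by (auto simp: has_law_def location_model_def)
  moreover have "prob_space (S t)" using assms(1) by (simp add: law_family_def)
  ultimately show ?thesis by (simp add: prob_space.prob_space_distr)
qed

text \<open>Strict monotonicity is what turns thresholds on posterior probabilities into thresholds
  on \<open>\<phi>\<close>.\<close>

lemma cdf_strict_mono_if_full_support:
  assumes "real_distribution F" and "measure_support F = UNIV"
  shows "strict_mono (cdf F)"
proof (rule strict_monoI)
  fix x y :: real assume "x < y"
  interpret real_distribution F by fact
  have "(x + y) / 2 \<in> measure_support F" using assms(2) by simp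
  then have "emeasure F {x<..<y} > 0"
    unfolding measure_support_def using \<open>x < y\<close> by (auto dest!: spec[of _ "{x<..<y}"])
  then have "0 < measure F {x<..<y}" by (simp add: emeasure_eq_measure)
  also have "\<dots> \<le> measure F {x<..y}" by (intro finite_measure_mono) auto
  finally show "cdf F x < cdf F y" using cdf_diff_eq[OF \<open>x < y\<close>] by simp
qed

lemma continuous_cdf_tails:
  assumes "real_distribution F" and "continuous_on UNIV (cdf F)"
  shows "measure F {x<..} = 1 - cdf F x" and "measure F {x..} = 1 - cdf F x"
proof -
  interpret real_distribution F by fact
  have "measure F {x} = 0"
    using assms(2) isCont_cdf by (simp add: continuous_on_eq_continuous_at)
  moreover show gt: "measure F {x<..} = 1 - cdf F x"
    using prob_compl[of "{..x}"] by (simp add: cdf_def Compl_eq_Diff_UNIV[symmetric])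
  ultimately show "measure F {x..} = 1 - cdf F x"
    using finite_measure_Union[of "{x}" "{x<..}"] ivl_disj_un_singleton(1)[of x] by simp
qed

lemma cdf_quantile_exists:
  assumes "real_distribution F" and "continuous_on UNIV (cdf F)" and "0 < \<alpha>" "\<alpha> < 1"
  obtains z where "cdf F z = \<alpha>"
proof -
  interpret real_distribution F by fact
  have "eventually (\<lambda>x. cdf F x < \<alpha>) at_bot"
    using cdf_lim_at_bot assms by (simp add: order_tendsto_iff)
  then obtain a where a: "cdf F a < \<alpha>" by (auto simp: eventually_at_bot_linorder)
  have "eventually (\<lambda>x. cdf F x > \<alpha>) at_top"
    using cdf_lim_at_top_prob assms by (simp add: order_tendsto_iff)
  then obtain b where b: "cdf F b > \<alpha>" by (auto simp: eventually_at_top_linorder)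
  have "a \<le> b" using a b cdf_nondecreasing[of b a] by linarith
  then obtain z where "cdf F z = \<alpha>"
    using IVT'[of "cdf F" a \<alpha> b] a b continuous_on_subset[OF assms(2)] by auto
  then show ?thesis by (rule that)
qed

text \<open>What condition (A) provides for the test: the posterior law of lower half-spaces and the sampling
  law of upper ones, both through the same \<open>F\<close> by its symmetry. Closed and open upper half-spaces get
  the same probability because a continuous CDF has no atoms.\<close>

lemma condition_A_half_space_probs:
  assumes A: "condition_A S Q \<phi>" and \<alpha>: "0 < \<alpha>" "\<alpha> < 1"
    and laws: "law_family S" "law_family Q"
  obtains F z where "real_distribution F" "strict_mono (cdf F)" "continuous_on UNIV (cdf F)"
    and "cdf F z = \<alpha>"
    and "\<And>x c. {\<theta>. \<phi> \<theta> \<le> c} \<in> sets (Q x)"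
    and "\<And>x c. measure (Q x) {\<theta>. \<phi> \<theta> \<le> c} = cdf F (c - \<phi> x)"
    and "\<And>\<theta> c. {x. c \<le> \<phi> x} \<in> sets (S \<theta>)"
    and "\<And>\<theta> c. measure (S \<theta>) {x. c \<le> \<phi> x} = cdf F (\<phi> \<theta> - c)"
    and "\<And>\<theta> c. {x. c < \<phi> x} \<in> sets (S \<theta>)"
    and "\<And>\<theta> c. measure (S \<theta>) {x. c < \<phi> x} = cdf F (\<phi> \<theta> - c)"
proof -
  from A obtain F where F: "real_distribution F" "continuous_on UNIV (cdf F)"
    "measure_support F = UNIV" and sym: "\<And>x. cdf F (- x) = 1 - cdf F x"
    and loc: "\<And>t. has_law (S t) (\<lambda>s. \<phi> s - \<phi> t) F" "\<And>t. has_law (Q t) (\<lambda>s. \<phi> s - \<phi> t) F"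
    unfolding condition_A_def location_model_def by blast
  obtain z where z: "cdf F z = \<alpha>" using cdf_quantile_exists[OF F(1,2) \<alpha>] .
  have gt: "measure F {x<..} = cdf F (- x)" and ge: "measure F {x..} = cdf F (- x)" for x
    using continuous_cdf_tails[OF F(1,2), of x] sym[of x] by simp_all
  note S = location_preimage[OF laws(1) loc(1)] and Q = location_preimage[OF laws(2) loc(2)]
  have shift: "{v. t + v \<le> c} = {..c - t}" "{v. c \<le> t + v} = {c - t..}" "{v. c < t + v} = {c - t<..}"
    for t c :: real by auto
  show ?thesis
    using that[OF F(1) cdf_strict_mono_if_full_support[OF F(1,3)] F(2) z]
      Q[of "{..c}" for c] S[of "{c..}" for c] S[of "{c<..}" for c]
    by (simp add: shift gt ge cdf_def)
qed

text \<open>A functional vanishing identically would have the point mass at 0 as its law, whose CDF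
  is not strictly increasing; and a nonzero functional takes every value on multiples of one vector.\<close>

lemma condition_A_surj:
  assumes "condition_A S Q \<phi>" and "law_family S"
  obtains t where "\<phi> t = (c::real)"
proof -
  from assms(1) obtain F where lin: "bounded_linear \<phi>" and F: "real_distribution F"
    "measure_support F = UNIV" and loc: "\<And>t. has_law (S t) (\<lambda>s. \<phi> s - \<phi> t) F"
    unfolding condition_A_def location_model_def by blast
  interpret F: real_distribution F by fact
  interpret \<phi>: bounded_linear \<phi> by fact
  have "\<exists>w. \<phi> w \<noteq> 0"
  proof (rule ccontr)
    assume "\<nexists>w. \<phi> w \<noteq> 0"
    then have "measure F {0<..} = 0"
      using location_preimage(2)[OF assms(2) loc, of "{0<..}" 0]
      by (simp add: greaterThan_def)
    moreover have "cdf F 0 < cdf F 1"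
      using cdf_strict_mono_if_full_support[OF F] by (simp add: strict_mono_def)
    ultimately show False
      using F.cdf_diff_eq[of 0 1] F.finite_measure_mono[of "{0<..1}" "{0<..}"]
      by (simp add: subset_eq)
  qed
  then obtain w where "\<phi> w \<noteq> 0" ..
  then have "\<phi> ((c / \<phi> w) *\<^sub>R w) = c" by (simp add: \<phi>.scaleR)
  then show ?thesis by (rule that)
qed

section \<open>Null hypotheses inside a half-space\<close>

lemma bayes_test_prob_space:
  assumes "bayes_test \<alpha> S Q \<Theta>0"
  shows "prob_space (S \<theta>)" "prob_space (Q x)" "law_family S" "law_family Q"
    "\<Theta>0 \<in> sets (Q x)" "rejection_region \<alpha> Q \<Theta>0 \<in> sets (S \<theta>)"
  using assms by (auto simp: bayes_test_def law_family_def)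

text \<open>The supremum of an unbounded set of reals carries no information; rejection probabilities are
  bounded by 1.\<close>

lemma rejection_prob_le_size:
  assumes test: "bayes_test \<alpha> S Q \<Theta>0" and "\<theta> \<in> \<Theta>0"
  shows "rejection_prob \<alpha> S Q \<Theta>0 \<theta> \<le> test_size \<alpha> S Q \<Theta>0"
proof -
  have "bdd_above (rejection_prob \<alpha> S Q \<Theta>0 ` \<Theta>0)"
    using bayes_test_prob_space(1)[OF test]
    by (auto simp: rejection_prob_def intro!: bdd_aboveI[where M=1] prob_space.prob_le_1)
  then show ?thesis unfolding test_size_def using assms(2) by (rule cSUP_upper2) simp
qed

lemma size_eq_if_attained:
  assumes "\<And>\<theta>. \<theta> \<in> \<Theta>0 \<Longrightarrow> rejection_prob \<alpha> S Q \<Theta>0 \<theta> \<le> r"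
    and "\<theta>1 \<in> \<Theta>0" and "rejection_prob \<alpha> S Q \<Theta>0 \<theta>1 = r"
  shows "test_size \<alpha> S Q \<Theta>0 = r"
  unfolding test_size_def using assms by (intro cSup_eq_maximum) (auto intro: rev_image_eqI)

lemma half_space_size:
  fixes S Q :: "'a::real_normed_vector \<Rightarrow> 'a measure"
  assumes \<alpha>: "0 < \<alpha>" "\<alpha> < 1" and test: "bayes_test \<alpha> S Q {\<theta>. \<phi> \<theta> \<le> c}"
    and A: "condition_A S Q \<phi>"
  shows "\<phi> \<theta> = c \<Longrightarrow> rejection_prob \<alpha> S Q {\<theta>. \<phi> \<theta> \<le> c} \<theta> = \<alpha>"
    and "test_size \<alpha> S Q {\<theta>. \<phi> \<theta> \<le> c} = \<alpha>"
proof -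
  note laws = bayes_test_prob_space[OF test]
  obtain F z where F: "strict_mono (cdf F)" and z: "cdf F z = \<alpha>"
    and Q: "\<And>x c. measure (Q x) {\<theta>. \<phi> \<theta> \<le> c} = cdf F (c - \<phi> x)"
    and S: "\<And>\<theta> c. measure (S \<theta>) {x. c \<le> \<phi> x} = cdf F (\<phi> \<theta> - c)"
    by (rule condition_A_half_space_probs[OF A \<alpha> laws(3,4)]) (rule that; assumption)
  have "(cdf F (c - \<phi> x) \<le> \<alpha>) = (c - z \<le> \<phi> x)" for x
    using strict_mono_less_eq[OF F, of "c - \<phi> x" z] by (auto simp: z)
  then have rej: "rejection_prob \<alpha> S Q {\<theta>. \<phi> \<theta> \<le> c} \<theta> = cdf F (z + (\<phi> \<theta> - c))" for \<theta>
    using S[of \<theta> "c - z"] by (simp add: rejection_prob_def rejection_region_def Q algebra_simps)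
  then show "\<phi> \<theta> = c \<Longrightarrow> rejection_prob \<alpha> S Q {\<theta>. \<phi> \<theta> \<le> c} \<theta> = \<alpha>" for \<theta>
    by (simp add: z)
  obtain t where "\<phi> t = c" using condition_A_surj[OF A laws(3)] .
  moreover from this have "rejection_prob \<alpha> S Q {\<theta>. \<phi> \<theta> \<le> c} t = \<alpha>" by (simp add: rej z)
  moreover have "rejection_prob \<alpha> S Q {\<theta>. \<phi> \<theta> \<le> c} \<theta> \<le> \<alpha>" if "\<phi> \<theta> \<le> c" for \<theta>
    using strict_mono_less_eq[OF F, of "z + (\<phi> \<theta> - c)" z] that by (simp add: rej z)
  ultimately show "test_size \<alpha> S Q {\<theta>. \<phi> \<theta> \<le> c} = \<alpha>"
    by (intro size_eq_if_attained) auto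
qed

text \<open>The hyperplane need only touch the closure of \<open>\<Theta>0\<close>, so the bound \<open>\<alpha>\<close> is obtained as a limit
  of rejection probabilities along a sequence in \<open>\<Theta>0\<close>.\<close>

lemma size_ge_if_subset_half_space:
  fixes S Q :: "'a::real_normed_vector \<Rightarrow> 'a measure"
  assumes \<alpha>: "0 < \<alpha>" "\<alpha> < 1" and test: "bayes_test \<alpha> S Q \<Theta>0"
    and A: "condition_A S Q \<phi>" and sub: "\<Theta>0 \<subseteq> {\<theta>. \<phi> \<theta> \<le> c}" and "c \<in> \<phi> ` closure \<Theta>0"
  shows "\<alpha> \<le> test_size \<alpha> S Q \<Theta>0"
proof -
  note laws = bayes_test_prob_space[OF test]
  obtain F z where F: "strict_mono (cdf F)" "continuous_on UNIV (cdf F)" and z: "cdf F z = \<alpha>"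
    and Qm: "\<And>x c. {\<theta>. \<phi> \<theta> \<le> c} \<in> sets (Q x)"
    and Q: "\<And>x c. measure (Q x) {\<theta>. \<phi> \<theta> \<le> c} = cdf F (c - \<phi> x)"
    and S: "\<And>\<theta> c. measure (S \<theta>) {x. c \<le> \<phi> x} = cdf F (\<phi> \<theta> - c)"
    by (rule condition_A_half_space_probs[OF A \<alpha> laws(3,4)]) (rule that; assumption)
  have "measure (Q x) \<Theta>0 \<le> \<alpha>" if "c - z \<le> \<phi> x" for x
  proof -
    have "measure (Q x) \<Theta>0 \<le> cdf F (c - \<phi> x)"
      using finite_measure.finite_measure_mono[OF _ sub Qm[of c x]] laws(2)
      by (simp add: Q prob_space_def)
    also have "\<dots> \<le> \<alpha>" using strict_mono_less_eq[OF F(1), of "c - \<phi> x" z] that by (simp add: z)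
    finally show ?thesis .
  qed
  then have lower: "cdf F (z + (\<phi> \<theta> - c)) \<le> rejection_prob \<alpha> S Q \<Theta>0 \<theta>" for \<theta>
    using finite_measure.finite_measure_mono[OF prob_space.finite_measure[OF laws(1)] _ laws(6),
        of "{x. c - z \<le> \<phi> x}" \<theta>] S[of \<theta> "c - z"]
    by (auto simp: rejection_prob_def rejection_region_def algebra_simps)
  obtain t where t: "t \<in> closure \<Theta>0" "\<phi> t = c" using assms(6) by auto
  then obtain X where X: "\<And>n. X n \<in> \<Theta>0" "X \<longlonglongrightarrow> t" by (auto simp: closure_sequential)
  have "bounded_linear \<phi>" using A by (simp add: condition_A_def)
  then have "(\<lambda>n. z + (\<phi> (X n) - c)) \<longlonglongrightarrow> z + (\<phi> t - c)"
    by (intro tendsto_intros bounded_linear.tendsto[OF _ X(2)])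
  then have "(\<lambda>n. cdf F (z + (\<phi> (X n) - c))) \<longlonglongrightarrow> cdf F (z + (\<phi> t - c))"
    using F(2) isCont_tendsto_compose continuous_on_eq_continuous_at open_UNIV by blast
  then have "(\<lambda>n. cdf F (z + (\<phi> (X n) - c))) \<longlonglongrightarrow> \<alpha>" by (simp add: t z)
  then show ?thesis
    by (rule LIMSEQ_le_const2)
      (use lower rejection_prob_le_size[OF test X(1)] order_trans in blast)
qed

section \<open>Distributions with positive density\<close>

lemma density_pos_if_lborel_pos:
  fixes A :: "'b::euclidean_space set"
  assumes f: "f \<in> borel_measurable borel" "\<And>p. 0 < f p" and A: "A \<in> sets borel" "emeasure lborel A > 0"
  shows "emeasure (density lborel (\<lambda>p. ennreal (f p))) A > 0"
proof (rule ccontr)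
  assume "\<not> ?thesis"
  then have "A \<in> null_sets (density lborel (\<lambda>p. ennreal (f p)))"
    using A(1) by (auto simp: null_sets_def)
  then have "AE x in lborel. x \<in> A \<longrightarrow> ennreal (f x) = 0"
    using f(1) by (simp add: null_sets_density_iff)
  then have "AE x in lborel. x \<notin> A"
    by eventually_elim (use f(2) in \<open>auto simp: ennreal_eq_0_iff not_le[symmetric]\<close>)
  then have "emeasure lborel A = 0"
    using A(1) by (simp add: AE_iff_null_sets null_setsD1)
  then show False using A(2) by simp
qed

lemma open_lborel_pos:
  fixes A :: "'b::euclidean_space set"
  assumes "open A" "a \<in> A"
  shows "emeasure lborel A > 0"
proof -
  obtain r where r: "r > 0" "ball a r \<subseteq> A" using assms openE by blast
  have "emeasure lborel (ball a r) \<noteq> 0"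
    using content_ball_pos[OF r(1), of a] by (auto simp: measure_def)
  moreover have "emeasure lborel (ball a r) \<le> emeasure lborel A"
    using assms(1) by (intro emeasure_mono r) auto
  ultimately show ?thesis by (metis not_gr_zero le_zero_eq)
qed

text \<open>Lebesgue measure is translation invariant and equivalent to \<open>F\<close>, so a set charged by Lebesgue
  measure is charged by every translate of \<open>F\<close>.\<close>

lemma positive_pdf_translate_pos:
  assumes "has_positive_pdf F" and "prob_space F" and A: "A \<in> sets borel" "emeasure lborel A > 0"
  shows "measure F {v. q + v \<in> A} > 0"
proof -
  interpret prob_space F by fact
  have B: "{v. q + v \<in> A} \<in> sets borel"
    using measurable_sets[OF _ A(1), of "\<lambda>v. q + v" borel] by (simp add: vimage_def)
  have "emeasure lborel A = emeasure (distr lborel borel ((+) q)) A" by (simp add: lborel_distr_plus)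
  also have "\<dots> = emeasure lborel {v. q + v \<in> A}"
    using A(1) by (subst emeasure_distr) (auto simp: vimage_def)
  finally have "emeasure lborel {v. q + v \<in> A} > 0" using A(2) by simp
  then have "emeasure F {v. q + v \<in> A} > 0"
    using assms(1) density_pos_if_lborel_pos[OF _ _ B] by (auto simp: has_positive_pdf_def)
  then show ?thesis by (simp add: emeasure_eq_measure)
qed

text \<open>Passing to a Borel subset is what allows \<open>\<Delta>\<close>, an arbitrary Lebesgue set, to be measured by
  laws on the Borel sets.\<close>

lemma lebesgue_pos_borel_subset:
  assumes "emeasure lebesgue A > 0"
  obtains B where "B \<in> sets borel" "B \<subseteq> A" "emeasure lborel B > 0"
proof -
  have "A \<in> sets lebesgue" using assms emeasure_notin_sets by fastforce
  then show ?thesis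
    using that[of "main_part lborel A"] assms main_part_null_part_Un[of A lborel]
      main_part_sets[of A lborel] Un_upper1[of "main_part lborel A" "null_part lborel A"]
    by simp
qed

text \<open>An open set through a point of a hyperplane reaches strictly to its negative side: move from
  \<open>p\<close> a little against \<open>h u\<close> times \<open>u\<close>, a direction along which \<open>h\<close> decreases whatever the sign of \<open>h u\<close>.\<close>

lemma open_meets_open_half_space:
  fixes h :: "'b::euclidean_space \<Rightarrow> real"
  assumes "linear h" "h u \<noteq> 0" "open A" "p \<in> A"
  obtains q where "q \<in> A" "h q < h p"
proof -
  have "((\<lambda>e. p - (e * h u) *\<^sub>R u) \<longlongrightarrow> p - (0 * h u) *\<^sub>R u) (at_right 0)"
    by (intro tendsto_intros)
  then have "\<forall>\<^sub>F e in at_right 0. p - (e * h u) *\<^sub>R u \<in> A"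
    using assms(3,4) by (intro topological_tendstoD) auto
  moreover have "\<forall>\<^sub>F e in at_right (0::real). e > 0" by (simp add: eventually_at_right_less)
  ultimately have "\<forall>\<^sub>F e in at_right (0::real). p - (e * h u) *\<^sub>R u \<in> A \<and> e > 0"
    by eventually_elim simp
  then obtain e where e: "p - (e * h u) *\<^sub>R u \<in> A" "e > 0"
    using eventually_happens'[OF trivial_limit_at_right_real] by blast
  have "h (p - (e * h u) *\<^sub>R u) = h p - e * (h u * h u)"
    using assms(1) by (simp add: linear_diff linear_cmul)
  also have "\<dots> < h p" using e assms(2) by (simp add: mult_pos_pos zero_less_mult_iff) (metis linorder_neqE_linordered_idom)
  finally show ?thesis using that e by blast
qed


section \<open>Strict inequalities on the hyperplane\<close>

text \<open>The set \<open>V\<close> consists of values of the statistic on the non-rejecting side of the critical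
  hyperplane of the half-space test at which the smaller null hypothesis is nevertheless rejected.
  The bound is needed with one \<open>V\<close> for all \<open>\<theta>\<close> at once: the size of the test is read off
  at parameters near the hyperplane, not on it.\<close>

lemma rejection_prob_lower_bound:
  fixes S Q :: "'a::real_normed_vector \<Rightarrow> 'a measure" and T :: "'a \<Rightarrow> real ^ 'd"
  assumes \<alpha>: "0 < \<alpha>" "\<alpha> < 1" and test: "bayes_test \<alpha> S Q \<Theta>0"
    and A: "condition_A S Q \<phi>" and sub: "\<Theta>0 \<subseteq> {\<theta>. \<phi> \<theta> \<le> c}"
    and loc: "location_model S Q T F2" and h: "linear h" "\<And>\<theta>. \<phi> \<theta> = h (T \<theta>)"
    and \<Delta>: "emeasure lebesgue {p. h p \<le> c \<and> p \<notin> T ` \<Theta>0} > 0"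
    and pdf: "has_positive_pdf F2" and cont: "posterior_prob_continuous Q T (T ` \<Theta>0)"
  obtains F z V v where "real_distribution F" "continuous_on UNIV (cdf F)" "cdf F z = \<alpha>"
    and "open V" "v \<in> V"
    and "\<And>\<theta>. cdf F (z + (\<phi> \<theta> - c)) + measure F2 {p. T \<theta> + p \<in> V} \<le> rejection_prob \<alpha> S Q \<Theta>0 \<theta>"
proof -
  note laws = bayes_test_prob_space[OF test]
  have locS: "\<And>t. has_law (S t) (\<lambda>s. T s - T t) F2" and locQ: "\<And>t. has_law (Q t) (\<lambda>s. T s - T t) F2"
    using loc by (auto simp: location_model_def)
  have F2: "prob_space F2" using location_model_prob_space[OF laws(3) loc] .
  obtain F z where F: "real_distribution F" "strict_mono (cdf F)" "continuous_on UNIV (cdf F)"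
    and z: "cdf F z = \<alpha>"
    and Qm: "\<And>x c. {\<theta>. \<phi> \<theta> \<le> c} \<in> sets (Q x)"
    and Q: "\<And>x c. measure (Q x) {\<theta>. \<phi> \<theta> \<le> c} = cdf F (c - \<phi> x)"
    and Sm: "\<And>\<theta> c. {x. c \<le> \<phi> x} \<in> sets (S \<theta>)"
    and S: "\<And>\<theta> c. measure (S \<theta>) {x. c \<le> \<phi> x} = cdf F (\<phi> \<theta> - c)"
    by (rule condition_A_half_space_probs[OF A \<alpha> laws(3,4)]) (rule that; assumption)
  obtain D where D: "D \<in> sets borel" "D \<subseteq> {p. h p \<le> c \<and> p \<notin> T ` \<Theta>0}" "emeasure lborel D > 0"
    using lebesgue_pos_borel_subset[OF \<Delta>] .
  obtain g where Bm: "\<And>x. {\<theta>. T \<theta> \<in> T ` \<Theta>0} \<in> sets (Q x)" and g: "continuous_on (range T) g"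
    and gQ: "\<And>x. measure (Q x) {\<theta>. T \<theta> \<in> T ` \<Theta>0} = g (T x)"
    using cont unfolding posterior_prob_continuous_def by blast
  have post_le: "measure (Q x) \<Theta>0 \<le> g (T x)" and g_less: "g (T x) < cdf F (c - \<phi> x)" for x
  proof -
    interpret Qx: prob_space "Q x" by (rule laws(2))
    note preD = location_preimage[OF laws(4) locQ D(1), where t=x]
    show "measure (Q x) \<Theta>0 \<le> g (T x)"
      unfolding gQ[symmetric] using Bm by (intro Qx.finite_measure_mono) auto
    have "g (T x) + measure F2 {p. T x + p \<in> D} = measure (Q x) ({\<theta>. T \<theta> \<in> T ` \<Theta>0} \<union> {\<theta>. T \<theta> \<in> D})"
      using D(2) Bm preD by (subst Qx.finite_measure_Union) (auto simp: gQ)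
    also have "\<dots> \<le> measure (Q x) {\<theta>. \<phi> \<theta> \<le> c}"
      using D(2) sub h(2) by (intro Qx.finite_measure_mono Qm) auto
    finally show "g (T x) < cdf F (c - \<phi> x)"
      using positive_pdf_translate_pos[OF pdf F2 D(1,3), of "T x"] by (simp add: Q)
  qed
  have rej_half: "measure (Q x) \<Theta>0 \<le> \<alpha>" if "c - z \<le> \<phi> x" for x
  proof -
    have "cdf F (c - \<phi> x) \<le> \<alpha>"
      using strict_mono_less_eq[OF F(2), of "c - \<phi> x" z] that by (simp add: z)
    with post_le[of x] g_less[of x] show ?thesis by linarith
  qed
  obtain x0 where x0: "\<phi> x0 = c - z" using condition_A_surj[OF A laws(3)] .
  \<comment> \<open>Continuity is only available on the range of \<open>T\<close>, which need not be open; \<open>U\<close> is an ambient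
    open set cutting out the same part of the range.\<close>
  obtain U where U: "open U" "U \<inter> range T = g -` {..<\<alpha>} \<inter> range T"
    using g unfolding continuous_on_open_invariant by (metis open_lessThan)
  have "T x0 \<in> U" using U(2) g_less[of x0] by (auto simp: x0 z)
  obtain x1 where "\<phi> x1 = 1" using condition_A_surj[OF A laws(3)] .
  then have "h (T x1) \<noteq> 0" using h(2) by simp
  then obtain v where v: "v \<in> U" "h v < c - z"
    using open_meets_open_half_space[OF h(1) _ U(1) \<open>T x0 \<in> U\<close>] x0 h(2) by metis
  define V where "V = U \<inter> {p. h p < c - z}"
  have "open V" unfolding V_def
    using h(1) by (intro open_Int U(1) open_Collect_less linear_continuous_on continuous_intros)
      (simp add: linear_conv_bounded_linear)
  have rejV: "measure (Q x) \<Theta>0 \<le> \<alpha>" if "T x \<in> V" for x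
    using post_le[of x] U(2) that by (force simp: V_def)
  have "cdf F (z + (\<phi> \<theta> - c)) + measure F2 {p. T \<theta> + p \<in> V} \<le> rejection_prob \<alpha> S Q \<Theta>0 \<theta>" for \<theta>
  proof -
    interpret S\<theta>: prob_space "S \<theta>" by (rule laws(1))
    note preV = location_preimage[OF laws(3) locS borel_open[OF \<open>open V\<close>], where t=\<theta>]
    have "measure (S \<theta>) {x. c - z \<le> \<phi> x} + measure F2 {p. T \<theta> + p \<in> V}
      = measure (S \<theta>) ({x. c - z \<le> \<phi> x} \<union> {x. T x \<in> V})"
      using preV Sm by (subst S\<theta>.finite_measure_Union) (auto simp: V_def h(2))
    also have "\<dots> \<le> rejection_prob \<alpha> S Q \<Theta>0 \<theta>"
      unfolding rejection_prob_def using laws(6) rej_half rejV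
      by (intro S\<theta>.finite_measure_mono) (auto simp: rejection_region_def)
    finally show ?thesis using S[of \<theta> "c - z"] by (simp add: algebra_simps)
  qed
  then show ?thesis using that[OF F(1,3) z \<open>open V\<close>, of v] v by (simp add: V_def)
qed

text \<open>For the size, a parameter \<open>t\<close> on the hyperplane is approached from within \<open>\<Theta>0\<close>. The first term of
  the lower bound tends to \<open>\<alpha>\<close>, and the second stays above a constant, because a ball slightly smaller than
  one inside \<open>V\<close> keeps its translates in \<open>V\<close> under small changes of \<open>T \<theta>\<close>.\<close>

lemma rejection_prob_gt_on_hyperplane:
  fixes S Q :: "'a::real_normed_vector \<Rightarrow> 'a measure" and T :: "'a \<Rightarrow> real ^ 'd"
  assumes \<alpha>: "0 < \<alpha>" "\<alpha> < 1" and test: "bayes_test \<alpha> S Q \<Theta>0"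
    and A: "condition_A S Q \<phi>" and sub: "\<Theta>0 \<subseteq> {\<theta>. \<phi> \<theta> \<le> c}"
    and loc: "location_model S Q T F2" and h: "linear h" "\<And>\<theta>. \<phi> \<theta> = h (T \<theta>)"
    and \<Delta>: "emeasure lebesgue {p. h p \<le> c \<and> p \<notin> T ` \<Theta>0} > 0"
    and pdf: "has_positive_pdf F2" and cont: "posterior_prob_continuous Q T (T ` \<Theta>0)"
  shows "\<phi> \<theta> = c \<Longrightarrow> \<alpha> < rejection_prob \<alpha> S Q \<Theta>0 \<theta>"
    and "continuous_on UNIV T \<Longrightarrow> c \<in> \<phi> ` closure \<Theta>0 \<Longrightarrow> \<alpha> < test_size \<alpha> S Q \<Theta>0"
proof -
  have F2: "prob_space F2"
    using location_model_prob_space[OF bayes_test_prob_space(3)[OF test] loc] .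
  interpret F2: prob_space F2 by fact
  have F2sets: "sets F2 = sets borel" using pdf by (auto simp: has_positive_pdf_def)
  obtain F z V v where F: "real_distribution F" "continuous_on UNIV (cdf F)" and z: "cdf F z = \<alpha>"
    and V: "open V" "v \<in> V"
    and lower: "\<And>\<theta>. cdf F (z + (\<phi> \<theta> - c)) + measure F2 {p. T \<theta> + p \<in> V} \<le> rejection_prob \<alpha> S Q \<Theta>0 \<theta>"
    by (rule rejection_prob_lower_bound[OF \<alpha> test A sub loc h \<Delta> pdf cont]) (rule that; assumption)
  have pos: "measure F2 {p. q + p \<in> W} > 0" if "open W" "w \<in> W" for q w W
    using positive_pdf_translate_pos[OF pdf F2 borel_open[OF that(1)] open_lborel_pos[OF that]] .
  show "\<alpha> < rejection_prob \<alpha> S Q \<Theta>0 \<theta>" if "\<phi> \<theta> = c"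
    using lower[of \<theta>] pos[OF V, of "T \<theta>"] that by (simp add: z)
  show "\<alpha> < test_size \<alpha> S Q \<Theta>0" if T: "continuous_on UNIV T" and c: "c \<in> \<phi> ` closure \<Theta>0"
  proof -
    obtain t where t: "t \<in> closure \<Theta>0" "\<phi> t = c" using c by auto
    then obtain X where X: "\<And>n. X n \<in> \<Theta>0" "X \<longlonglongrightarrow> t" by (auto simp: closure_sequential)
    obtain r where r: "r > 0" "ball v r \<subseteq> V" using V openE by blast
    define \<delta> where "\<delta> = measure F2 {p. T t + p \<in> ball v (r / 2)}"
    have "\<delta> > 0" unfolding \<delta>_def using r(1) by (intro pos[of _ v]) auto
    have "bounded_linear \<phi>" using A by (simp add: condition_A_def)
    then have "(\<lambda>n. z + (\<phi> (X n) - c)) \<longlonglongrightarrow> z + (\<phi> t - c)"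
      by (intro tendsto_intros bounded_linear.tendsto[OF _ X(2)])
    then have "(\<lambda>n. cdf F (z + (\<phi> (X n) - c))) \<longlonglongrightarrow> cdf F (z + (\<phi> t - c))"
      using F(2) isCont_tendsto_compose continuous_on_eq_continuous_at open_UNIV by blast
    then have "(\<lambda>n. cdf F (z + (\<phi> (X n) - c))) \<longlonglongrightarrow> \<alpha>" by (simp add: t z)
    then have "\<forall>\<^sub>F n in sequentially. \<alpha> - \<delta> < cdf F (z + (\<phi> (X n) - c))"
      using \<open>\<delta> > 0\<close> by (intro order_tendstoD) auto
    moreover have "(\<lambda>n. T (X n)) \<longlonglongrightarrow> T t"
      using T X(2) isCont_tendsto_compose continuous_on_eq_continuous_at open_UNIV by blast
    then have "\<forall>\<^sub>F n in sequentially. dist (T (X n)) (T t) < r / 2"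
      using r(1) by (intro tendstoD) auto
    ultimately have "\<forall>\<^sub>F n in sequentially. \<alpha> - \<delta> < cdf F (z + (\<phi> (X n) - c)) \<and> dist (T (X n)) (T t) < r / 2"
      by eventually_elim simp
    then obtain n where n: "\<alpha> - \<delta> < cdf F (z + (\<phi> (X n) - c))" "dist (T (X n)) (T t) < r / 2"
      using eventually_happens' sequentially_bot by blast
    have "{p. T t + p \<in> ball v (r / 2)} \<subseteq> {p. T (X n) + p \<in> V}"
    proof safe
      fix p assume "T t + p \<in> ball v (r / 2)"
      then have "dist v (T (X n) + p) < r"
        using n(2) dist_triangle[of v "T (X n) + p" "T t + p"] by (simp add: dist_commute)
      then show "T (X n) + p \<in> V" using r(2) by auto
    qed
    moreover have "open {p. T (X n) + p \<in> V}"
      using V(1) open_vimage[OF V(1), of "\<lambda>p. T (X n) + p"]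
      by (simp add: vimage_def continuous_intros)
    ultimately have "\<delta> \<le> measure F2 {p. T (X n) + p \<in> V}"
      unfolding \<delta>_def by (intro F2.finite_measure_mono) (auto simp: F2sets)
    then have "\<alpha> < rejection_prob \<alpha> S Q \<Theta>0 (X n)" using lower[of "X n"] n(1) by linarith
    also have "\<dots> \<le> test_size \<alpha> S Q \<Theta>0" using rejection_prob_le_size[OF test X(1)] .
    finally show ?thesis .
  qed
qed

text \<open>The mirror image of the previous argument: enlarging the half-space turns rejections into
  acceptances. The event \<open>{T \<in> B}\<close> with \<open>B = - (T ` (- \<Theta>0))\<close> is the largest one determined by \<open>T\<close> that implies
  \<open>\<Theta>0\<close>, hence its posterior probability bounds that of \<open>\<Theta>0\<close> from below.\<close>

lemma rejection_prob_less_on_hyperplane: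
  fixes S Q :: "'a::real_normed_vector \<Rightarrow> 'a measure" and T :: "'a \<Rightarrow> real ^ 'd"
  assumes \<alpha>: "0 < \<alpha>" "\<alpha> < 1" and test: "bayes_test \<alpha> S Q \<Theta>0"
    and A: "condition_A S Q \<phi>" 
    and loc: "location_model S Q T F2" and h: "linear h" "\<And>\<theta>. \<phi> \<theta> = h (T \<theta>)"
    and sub: "T ` {\<theta>. \<phi> \<theta> \<le> c} \<subseteq> - (T ` (- \<Theta>0))"
    and \<Delta>: "emeasure lebesgue {p. p \<in> - (T ` (- \<Theta>0)) \<and> c < h p} > 0"
    and pdf: "has_positive_pdf F2" and cont: "posterior_prob_continuous Q T (- (T ` (- \<Theta>0)))"
    and "\<phi> \<theta> = c"
  shows "rejection_prob \<alpha> S Q \<Theta>0 \<theta> < \<alpha>"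
proof -
  note laws = bayes_test_prob_space[OF test]
  have locS: "\<And>t. has_law (S t) (\<lambda>s. T s - T t) F2" and locQ: "\<And>t. has_law (Q t) (\<lambda>s. T s - T t) F2"
    using loc by (auto simp: location_model_def)
  have F2: "prob_space F2" using location_model_prob_space[OF laws(3) loc] .
  obtain F z where F: "strict_mono (cdf F)" and z: "cdf F z = \<alpha>"
    and Qm: "\<And>x c. {\<theta>. \<phi> \<theta> \<le> c} \<in> sets (Q x)"
    and Q: "\<And>x c. measure (Q x) {\<theta>. \<phi> \<theta> \<le> c} = cdf F (c - \<phi> x)"
    and Sm: "\<And>\<theta> c. {x. c < \<phi> x} \<in> sets (S \<theta>)"
    and S: "\<And>\<theta> c. measure (S \<theta>) {x. c < \<phi> x} = cdf F (\<phi> \<theta> - c)"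
    by (rule condition_A_half_space_probs[OF A \<alpha> laws(3,4)]) (rule that; assumption)
  define B where "B = - (T ` (- \<Theta>0))"
  obtain D where D: "D \<in> sets borel" "D \<subseteq> {p. p \<in> B \<and> c < h p}" "emeasure lborel D > 0"
    using lebesgue_pos_borel_subset[OF \<Delta>] unfolding B_def .
  obtain g where Bm: "\<And>x. {\<theta>. T \<theta> \<in> B} \<in> sets (Q x)" and g: "continuous_on (range T) g"
    and gQ: "\<And>x. measure (Q x) {\<theta>. T \<theta> \<in> B} = g (T x)"
    using cont unfolding posterior_prob_continuous_def B_def by blast
  have post_ge: "g (T x) \<le> measure (Q x) \<Theta>0" and g_gt: "cdf F (c - \<phi> x) < g (T x)" for x
  proof -
    interpret Qx: prob_space "Q x" by (rule laws(2))
    note preD = location_preimage[OF laws(4) locQ D(1), where t=x]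
    show "g (T x) \<le> measure (Q x) \<Theta>0"
      unfolding gQ[symmetric] using laws(5) by (intro Qx.finite_measure_mono) (auto simp: B_def)
    have "cdf F (c - \<phi> x) + measure F2 {p. T x + p \<in> D} = measure (Q x) ({\<theta>. \<phi> \<theta> \<le> c} \<union> {\<theta>. T \<theta> \<in> D})"
      unfolding Q[symmetric] using D(2) Qm preD
      by (subst Qx.finite_measure_Union) (auto simp: h(2))
    also have "\<dots> \<le> g (T x)"
      unfolding gQ[symmetric] using D(2) sub by (intro Qx.finite_measure_mono Bm) (auto simp: B_def)
    finally show "cdf F (c - \<phi> x) < g (T x)"
      using positive_pdf_translate_pos[OF pdf F2 D(1,3), of "T x"] by simp
  qed
  have rej_half: "c - z < \<phi> x" if "measure (Q x) \<Theta>0 \<le> \<alpha>" for x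
  proof -
    have "cdf F (c - \<phi> x) < cdf F z" using post_ge[of x] g_gt[of x] that by (simp add: z)
    then show ?thesis using strict_mono_less[OF F] by auto
  qed
  obtain x0 where x0: "\<phi> x0 = c - z" using condition_A_surj[OF A laws(3)] .
  \<comment> \<open>As \<open>T\<close> need not be onto, \<open>U\<close> is an ambient open set agreeing with the relatively open set
    \<open>{g > \<alpha>}\<close> on the range of \<open>T\<close>.\<close>
  obtain U where U: "open U" "U \<inter> range T = g -` {\<alpha><..} \<inter> range T"
    using g unfolding continuous_on_open_invariant by (metis open_greaterThan)
  have "T x0 \<in> U" using U(2) g_gt[of x0] by (auto simp: x0 z)
  obtain x1 where "\<phi> x1 = 1" using condition_A_surj[OF A laws(3)] .
  then have "h (T x1) \<noteq> 0" using h(2) by simp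
  then obtain v where v: "v \<in> U" "c - z < h v"
    using open_meets_open_half_space[OF linear_compose_neg[OF h(1)] _ U(1) \<open>T x0 \<in> U\<close>, of "T x1"] x0 h(2)
    by (metis neg_equal_0_iff_equal neg_less_iff_less)
  define V where "V = U \<inter> {p. c - z < h p}"
  have "open V" unfolding V_def
    using h(1) by (intro open_Int U(1) open_Collect_less linear_continuous_on continuous_intros)
      (simp add: linear_conv_bounded_linear)
  have rejV: "\<not> measure (Q x) \<Theta>0 \<le> \<alpha>" if "T x \<in> V" for x
    using post_ge[of x] U(2) that by (force simp: V_def)
  interpret S\<theta>: prob_space "S \<theta>" by (rule laws(1))
  note preV = location_preimage[OF laws(3) locS borel_open[OF \<open>open V\<close>], where t=\<theta>]
  have "rejection_prob \<alpha> S Q \<Theta>0 \<theta> + measure F2 {p. T \<theta> + p \<in> V}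
    = measure (S \<theta>) (rejection_region \<alpha> Q \<Theta>0 \<union> {x. T x \<in> V})"
    unfolding rejection_prob_def using preV laws(6) rejV
    by (subst S\<theta>.finite_measure_Union) (auto simp: rejection_region_def)
  also have "\<dots> \<le> measure (S \<theta>) {x. c - z < \<phi> x}"
    using rej_half Sm by (intro S\<theta>.finite_measure_mono) (auto simp: rejection_region_def V_def h(2))
  also have "\<dots> = \<alpha>" using S[of \<theta> "c - z"] \<open>\<phi> \<theta> = c\<close> by (simp add: z)
  finally show ?thesis
    using positive_pdf_translate_pos[OF pdf F2 borel_open open_lborel_pos, of V v "T \<theta>"] \<open>open V\<close> v
    by (simp add: V_def)
qed

section \<open>Null hypotheses outside every half-space\<close>

lemma std_normal_cdf_continuous: "continuous_on UNIV (cdf std_normal_distribution)"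
proof -
  interpret real_distribution std_normal_distribution by (rule real_dist_normal_dist)
  have "emeasure std_normal_distribution {x} = 0" for x
    by (subst emeasure_density)
      (auto intro!: nn_integral_0_iff_AE[THEN iffD2] AE_I[where N="{x}"] simp: indicator_def)
  then show ?thesis
    by (simp add: continuous_on_eq_continuous_at isCont_cdf measure_def)
qed

lemma std_normal_full_support: "measure_support std_normal_distribution = UNIV"
  unfolding measure_support_def
  by (auto intro!: density_pos_if_lborel_pos open_lborel_pos normal_density_pos)

lemma std_normal_cdf_symmetric:
  "cdf std_normal_distribution (- x) = 1 - cdf std_normal_distribution x"
proof -
  let ?N = "std_normal_distribution"
  have "emeasure ?N {..- x} = (\<integral>\<^sup>+ y. ennreal (std_normal_density y) * indicator {..- x} y \<partial>distr lborel borel uminus)"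
    by (subst emeasure_density) (auto simp: lborel_distr_uminus)
  also have "\<dots> = (\<integral>\<^sup>+ y. ennreal (std_normal_density (- y)) * indicator {..- x} (- y) \<partial>lborel)"
    by (subst nn_integral_distr) auto
  also have "\<dots> = (\<integral>\<^sup>+ y. ennreal (std_normal_density y) * indicator {x..} y \<partial>lborel)"
    by (intro nn_integral_cong) (auto simp: normal_density_def indicator_def)
  also have "\<dots> = emeasure ?N {x..}"
    by (subst emeasure_density) auto
  finally have "cdf ?N (- x) = measure ?N {x..}" by (simp add: cdf_def measure_def)
  then show ?thesis
    using continuous_cdf_tails(2)[OF real_dist_normal_dist std_normal_cdf_continuous] by simp
qed

text \<open>The map \<open>b\<close> selects the horizontal line carrying the law at \<open>t\<close>. Condition (A) for the first coordinate
  constrains only the first coordinate of \<open>b t\<close>, so the second one is free.\<close>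

definition horizontal_normal :: "(real ^ 2 \<Rightarrow> real ^ 2) \<Rightarrow> real ^ 2 \<Rightarrow> (real ^ 2) measure" where
  "horizontal_normal b t = distr std_normal_distribution borel (\<lambda>z. b t + z *\<^sub>R axis 1 1)"

lemma horizontal_measurable:
  "(\<lambda>z. p + z *\<^sub>R axis 1 1 :: real ^ 2) \<in> borel_measurable std_normal_distribution"
  using borel_measurable_continuous_onI[of "\<lambda>z. p + z *\<^sub>R axis 1 1 :: real ^ 2"]
  by (simp add: continuous_intros)

lemma sets_horizontal_normal: "sets (horizontal_normal b t) = sets borel"
  by (simp add: horizontal_normal_def)

lemma law_family_horizontal_normal: "law_family (horizontal_normal b)"
  using prob_space.prob_space_distr[OF prob_space_normal_density[of 1 0] horizontal_measurable]
  by (simp add: law_family_def horizontal_normal_def)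

lemma measure_horizontal_normal:
  assumes "A \<in> sets borel"
  shows "measure (horizontal_normal b t) A
    = measure std_normal_distribution {z. b t + z *\<^sub>R axis 1 1 \<in> A}"
  unfolding horizontal_normal_def using measure_distr[OF horizontal_measurable, of A "b t"] assms
  by (simp add: vimage_def)

lemma condition_A_horizontal_normal:
  assumes "\<And>t. b t $ 1 = t $ 1"
  shows "condition_A (horizontal_normal b) (horizontal_normal b) (\<lambda>t. t $ 1)"
proof -
  have "has_law (horizontal_normal b t) (\<lambda>x. x $ 1 - t $ 1) std_normal_distribution" for t
  proof -
    have m: "(\<lambda>x::real^2. x $ 1 - t $ 1) \<in> borel_measurable borel"
      by (intro borel_measurable_continuous_onI continuous_intros)
    have "distr (horizontal_normal b t) borel (\<lambda>x. x $ 1 - t $ 1) = distr std_normal_distribution borel (\<lambda>z. z)"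
      unfolding horizontal_normal_def using m
      by (subst distr_distr[OF _ horizontal_measurable]) (auto simp: o_def assms axis_def)
    also have "\<dots> = std_normal_distribution" by (rule distr_id2) simp
    finally show ?thesis
      using m by (simp add: has_law_def horizontal_normal_def)
  qed
  then show ?thesis
    unfolding condition_A_def location_model_def
    using real_dist_normal_dist std_normal_cdf_continuous std_normal_full_support std_normal_cdf_symmetric
    by (auto intro!: bounded_linear_vec_nth exI[of _ std_normal_distribution])
qed

text \<open>A nonzero linear functional cannot vanish on the whole complement of a line, and this complement is
  closed under nonzero scaling, so the functional is unbounded above there.\<close>

lemma off_axis_not_within_half_space:
  assumes "{t :: real ^ 2. t $ 2 \<noteq> 0} \<subseteq> A"
  shows "\<not> within_half_space A"
proof
  assume "within_half_space A"
  then obtain h :: "real ^ 2 \<Rightarrow> real" and c where h: "bounded_linear h" "h \<noteq> (\<lambda>_. 0)"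
    and le: "\<And>t. t \<in> A \<Longrightarrow> h t \<le> c"
    unfolding within_half_space_def by blast
  interpret h: bounded_linear h by fact
  obtain w where w: "h w \<noteq> 0" using h(2) by auto
  have "\<exists>t. t $ 2 \<noteq> 0 \<and> h t \<noteq> 0"
  proof (cases "w $ 2 = 0")
    case True
    then have "h (w + axis 2 1) - h (axis 2 1) \<noteq> 0" using w by (simp add: h.add)
    then have "h (w + axis 2 1) \<noteq> 0 \<or> h (axis 2 1) \<noteq> 0" by auto
    moreover have "(w + axis 2 1) $ 2 \<noteq> 0" "(axis 2 1 :: real ^ 2) $ 2 \<noteq> 0"
      using True by (simp_all add: axis_def)
    ultimately show ?thesis by blast
  qed (use w in blast)
  then obtain t where t: "t $ 2 \<noteq> 0" "h t \<noteq> 0" by blast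
  \<comment> \<open>The multiple of \<open>t\<close> at which \<open>h\<close> equals \<open>\<bar>c\<bar> + 1\<close>.\<close>
  have "h (((\<bar>c\<bar> + 1) / h t) *\<^sub>R t) \<le> c"
    using t assms by (intro le) auto
  then show False using t(2) by (simp add: h.scaleR)
qed

lemma non_half_space_setting_horizontal_normal:
  assumes "\<And>t. b t $ 1 = t $ 1" and "\<Theta>0 \<in> sets borel" and "\<Theta>0 \<noteq> UNIV"
    and "{t. t $ 2 \<noteq> 0} \<subseteq> \<Theta>0"
    and "rejection_region \<alpha> (horizontal_normal b) \<Theta>0 \<in> sets borel"
  shows "non_half_space_setting \<alpha> (horizontal_normal b) (horizontal_normal b) \<Theta>0"
  using assms condition_A_horizontal_normal[OF assms(1)] off_axis_not_within_half_space[OF assms(4)]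
  by (auto simp: non_half_space_setting_def bayes_test_def law_family_horizontal_normal
      sets_horizontal_normal)

lemma std_normal_UNIV: "measure std_normal_distribution UNIV = 1"
  using prob_space.prob_space[OF prob_space_normal_density[of 1 0]] by simp

lemma off_axis_borel: "{t :: real ^ 2. t $ 2 \<noteq> 0} \<in> sets borel"
  by (intro borel_open open_Collect_neq continuous_intros)

lemma off_axis_proper: "{t :: real ^ 2. t $ 2 \<noteq> 0} \<noteq> UNIV"
proof -
  have "0 \<notin> {t :: real ^ 2. t $ 2 \<noteq> 0}" by simp
  then show ?thesis by blast
qed

lemma off_axis_nonempty: "axis 2 1 \<in> {t :: real ^ 2. t $ 2 \<noteq> 0}"
  by (simp add: axis_def)

text \<open>All mass lies on the axis, which the null hypothesis misses: its posterior probability is 0 and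
  the test always rejects.\<close>

lemma projected_size_one:
  fixes b :: "real ^ 2 \<Rightarrow> real ^ 2"
  assumes \<alpha>: "0 < \<alpha>" and b: "b = (\<lambda>t. axis 1 (t $ 1))"
  defines "K \<equiv> horizontal_normal b"
  shows "non_half_space_setting \<alpha> K K {t. t $ 2 \<noteq> 0}"
    and "test_size \<alpha> K K {t. t $ 2 \<noteq> 0} = 1"
proof -
  have K: "measure (K x) {t. t $ 2 \<noteq> 0} = 0" for x
    unfolding K_def measure_horizontal_normal[OF off_axis_borel] by (simp add: b axis_def)
  have R: "rejection_region \<alpha> K {t. t $ 2 \<noteq> 0} = UNIV"
    using \<alpha> by (simp add: rejection_region_def K)
  show "non_half_space_setting \<alpha> K K {t. t $ 2 \<noteq> 0}"
    unfolding K_def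
    by (rule non_half_space_setting_horizontal_normal) (use off_axis_proper R off_axis_borel in \<open>auto simp: b axis_def K_def\<close>)
  have "rejection_prob \<alpha> K K {t. t $ 2 \<noteq> 0} \<theta> = 1" for \<theta>
    unfolding rejection_prob_def R unfolding K_def
    by (subst measure_horizontal_normal) (auto simp: std_normal_UNIV)
  then show "test_size \<alpha> K K {t. t $ 2 \<noteq> 0} = 1"
    by (intro size_eq_if_attained[OF _ off_axis_nonempty]) auto
qed

text \<open>The same null hypothesis as in \<open>projected_size_one\<close>, but each observation now stays on the line of its parameter.
  The null hypothesis is posterior-certain off the axis, so it is rejected only on the axis, where no parameter in it
  sends an observation.\<close>

lemma sliced_size_zero:
  assumes \<alpha>: "0 < \<alpha>" "\<alpha> < 1"
  defines "K \<equiv> horizontal_normal (\<lambda>t. t)"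
  shows "non_half_space_setting \<alpha> K K {t. t $ 2 \<noteq> 0}"
    and "test_size \<alpha> K K {t. t $ 2 \<noteq> 0} = 0"
proof -
  have K: "measure (K x) {t. t $ 2 \<noteq> 0} = (if x $ 2 = 0 then 0 else 1)" for x
    unfolding K_def measure_horizontal_normal[OF off_axis_borel]
    by (simp add: axis_def std_normal_UNIV)
  have R: "rejection_region \<alpha> K {t. t $ 2 \<noteq> 0} = {t. t $ 2 = 0}"
    using \<alpha> by (auto simp: rejection_region_def K)
  have Rm: "{t :: real ^ 2. t $ 2 = 0} \<in> sets borel"
    by (intro borel_closed closed_Collect_eq continuous_intros)
  show "non_half_space_setting \<alpha> K K {t. t $ 2 \<noteq> 0}"
    unfolding K_def
    by (rule non_half_space_setting_horizontal_normal) (use off_axis_proper R Rm off_axis_borel in \<open>auto simp: axis_def K_def\<close>)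
  have "rejection_prob \<alpha> K K {t. t $ 2 \<noteq> 0} \<theta> = 0" if "\<theta> \<in> {t. t $ 2 \<noteq> 0}" for \<theta>
    unfolding rejection_prob_def R unfolding K_def using that
    by (subst measure_horizontal_normal[OF Rm]) (auto simp: axis_def)
  then show "test_size \<alpha> K K {t. t $ 2 \<noteq> 0} = 0"
    by (intro size_eq_if_attained[OF _ off_axis_nonempty]) auto
qed

text \<open>On the axis this is the one-sided normal test, of size \<open>\<alpha>\<close>; on the other horizontal lines the null
  hypothesis is everything and never rejected.\<close>

lemma sliced_half_plane_size:
  assumes \<alpha>: "0 < \<alpha>" "\<alpha> < 1"
  defines "K \<equiv> horizontal_normal (\<lambda>t. t)" and "A \<equiv> {t :: real ^ 2. t $ 2 \<noteq> 0 \<or> t $ 1 \<le> 0}"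
  shows "non_half_space_setting \<alpha> K K A"
    and "test_size \<alpha> K K A = \<alpha>"
proof -
  let ?N = std_normal_distribution
  let ?\<Phi> = "cdf ?N"
  obtain z where z: "?\<Phi> z = \<alpha>"
    using cdf_quantile_exists[OF real_dist_normal_dist std_normal_cdf_continuous \<alpha>] .
  have mono: "strict_mono ?\<Phi>"
    using cdf_strict_mono_if_full_support[OF real_dist_normal_dist std_normal_full_support] .
  have A: "A \<in> sets borel"
  proof -
    have "{t :: real ^ 2. t $ 1 \<le> 0} \<in> sets borel"
      by (intro borel_closed closed_Collect_le continuous_intros)
    then have "{t. t $ 2 \<noteq> 0} \<union> {t :: real ^ 2. t $ 1 \<le> 0} \<in> sets borel"
      using off_axis_borel by blast
    then show ?thesis by (simp add: A_def Collect_disj_eq)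
  qed
  have half: "measure ?N {y. t + y \<le> c} = ?\<Phi> (c - t)" for t c
    by (auto simp: cdf_def intro!: arg_cong[where f="measure ?N"])
  have K: "measure (K x) A = (if x $ 2 = 0 then ?\<Phi> (- x $ 1) else 1)" for x
    unfolding K_def measure_horizontal_normal[OF A]
    by (simp add: A_def axis_def std_normal_UNIV half)
  have "(?\<Phi> (- x) \<le> \<alpha>) = (- z \<le> x)" for x
    using strict_mono_less_eq[OF mono, of "- x" z] by (auto simp: z)
  then have R: "rejection_region \<alpha> K A = {t. t $ 2 = 0 \<and> - z \<le> t $ 1}"
    using \<alpha> by (auto simp: rejection_region_def K)
  have Rm: "{t :: real ^ 2. t $ 2 = 0 \<and> - z \<le> t $ 1} \<in> sets borel"
    by (intro borel_closed closed_Collect_conj closed_Collect_eq closed_Collect_le continuous_intros)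
  show "non_half_space_setting \<alpha> K K A"
    unfolding K_def
  proof (rule non_half_space_setting_horizontal_normal)
    have "axis 1 1 \<notin> A" by (simp add: A_def axis_def)
    then show "A \<noteq> UNIV" by blast
    show "rejection_region \<alpha> (horizontal_normal (\<lambda>t. t)) A \<in> sets borel"
      using R Rm by (simp add: K_def)
  qed (use A in \<open>auto simp: A_def\<close>)
  have upper: "measure ?N {y. - z \<le> t + y} = ?\<Phi> (z + t)" for t
  proof -
    have "{y. - z \<le> t + y} = {- (z + t)..}" by auto
    then show ?thesis
      using continuous_cdf_tails(2)[OF real_dist_normal_dist std_normal_cdf_continuous, of "- (z + t)"]
        std_normal_cdf_symmetric[of "z + t"] by simp
  qed
  have rej: "rejection_prob \<alpha> K K A \<theta> = (if \<theta> $ 2 = 0 then ?\<Phi> (z + \<theta> $ 1) else 0)" for \<theta>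
    unfolding rejection_prob_def R unfolding K_def measure_horizontal_normal[OF Rm]
    by (simp add: axis_def upper)
  have "rejection_prob \<alpha> K K A \<theta> \<le> \<alpha>" if "\<theta> \<in> A" for \<theta>
    using strict_mono_less_eq[OF mono, of "z + \<theta> $ 1" z] that \<alpha> by (simp add: rej z) (simp add: A_def)
  moreover have "rejection_prob \<alpha> K K A 0 = \<alpha>" by (simp add: rej z)
  moreover have "0 \<in> A" by (simp add: A_def)
  ultimately show "test_size \<alpha> K K A = \<alpha>"
    by (intro size_eq_if_attained) auto
qed

section \<open>Size and type I error\<close>

theorem theorem1:
  fixes \<alpha> :: real
    and S Q :: "'a::banach \<Rightarrow> 'a measure"
    and \<Theta>0 :: "'a set"
  assumes \<alpha>: "0 < \<alpha>" "\<alpha> < 1"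
    and test: "bayes_test \<alpha> S Q \<Theta>0"
  shows
    "(\<forall>\<phi> c0. condition_A S Q \<phi> \<and> \<Theta>0 = {\<theta>. \<phi> \<theta> \<le> c0} \<longrightarrow>
        test_size \<alpha> S Q \<Theta>0 = \<alpha> \<and>
        (\<forall>\<theta>. \<phi> \<theta> = c0 \<longrightarrow> rejection_prob \<alpha> S Q \<Theta>0 \<theta> = \<alpha>))
     \<and>
     (\<forall>\<phi> c0. condition_A S Q \<phi> \<and> \<Theta>0 \<subseteq> {\<theta>. \<phi> \<theta> \<le> c0} \<and> c0 \<in> \<phi> ` closure \<Theta>0 \<longrightarrow>
        test_size \<alpha> S Q \<Theta>0 \<ge> \<alpha>)
     \<and>
     (\<forall>\<phi> c0 (\<phi>2 :: 'a \<Rightarrow> real ^ 'd) F2 \<phi>3.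
        condition_A S Q \<phi> \<and> \<Theta>0 \<subseteq> {\<theta>. \<phi> \<theta> \<le> c0} \<and> c0 \<in> \<phi> ` closure \<Theta>0 \<and>
        location_model S Q \<phi>2 F2 \<and>
        linear \<phi>3 \<and> (\<forall>\<theta>. \<phi> \<theta> = \<phi>3 (\<phi>2 \<theta>)) \<and>
        \<phi>2 ` \<Theta>0 \<subset> \<phi>2 ` {\<theta>. \<phi> \<theta> \<le> c0} \<and>
        emeasure lebesgue {p. \<phi>3 p \<le> c0 \<and> p \<notin> \<phi>2 ` \<Theta>0} > 0 \<and>
        has_positive_pdf F2 \<and>
        posterior_prob_continuous Q \<phi>2 (\<phi>2 ` \<Theta>0) \<longrightarrow>
        (\<forall>\<theta>. \<phi> \<theta> = c0 \<longrightarrow> rejection_prob \<alpha> S Q \<Theta>0 \<theta> > \<alpha>) \<and>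
        (continuous_on UNIV \<phi>2 \<longrightarrow> test_size \<alpha> S Q \<Theta>0 > \<alpha>))
     \<and>
     (\<forall>(S1 :: real ^ 'd \<Rightarrow> (real ^ 'd) measure) Q1 \<Theta>1 \<phi> c0 F2 \<theta>.
        bayes_test \<alpha> S1 Q1 \<Theta>1 \<and>
        support_point_at (closure \<Theta>1) \<phi> c0 \<theta> \<and>
        condition_A S1 Q1 \<phi> \<and> \<Theta>1 \<subset> {t. \<phi> t \<le> c0} \<and>
        location_model S1 Q1 (\<lambda>t. t) F2 \<and>
        emeasure lebesgue {p. \<phi> p \<le> c0 \<and> p \<notin> \<Theta>1} > 0 \<and>
        has_positive_pdf F2 \<and>
        posterior_prob_continuous Q1 (\<lambda>t. t) \<Theta>1 \<longrightarrow>
        rejection_prob \<alpha> S1 Q1 \<Theta>1 \<theta> > \<alpha>)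
     \<and>
     ((\<exists>(S :: real ^ 2 \<Rightarrow> (real ^ 2) measure) Q \<Theta>0.
         non_half_space_setting \<alpha> S Q \<Theta>0 \<and> test_size \<alpha> S Q \<Theta>0 > \<alpha>) \<and>
      (\<exists>(S :: real ^ 2 \<Rightarrow> (real ^ 2) measure) Q \<Theta>0.
         non_half_space_setting \<alpha> S Q \<Theta>0 \<and> test_size \<alpha> S Q \<Theta>0 = \<alpha>) \<and>
      (\<exists>(S :: real ^ 2 \<Rightarrow> (real ^ 2) measure) Q \<Theta>0.
         non_half_space_setting \<alpha> S Q \<Theta>0 \<and> test_size \<alpha> S Q \<Theta>0 < \<alpha>) \<and>
      (\<exists>(\<Theta>0 :: (real ^ 2) set) S Q S' Q'.
         non_half_space_setting \<alpha> S Q \<Theta>0 \<and> non_half_space_setting \<alpha> S' Q' \<Theta>0 \<and>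
         test_size \<alpha> S Q \<Theta>0 \<noteq> test_size \<alpha> S' Q' \<Theta>0))
     \<and>
     (\<forall>\<phi> c0 (\<phi>2 :: 'a \<Rightarrow> real ^ 'd) F2 \<phi>3.
        condition_A S Q \<phi> \<and>
        location_model S Q \<phi>2 F2 \<and>
        linear \<phi>3 \<and> (\<forall>\<theta>. \<phi> \<theta> = \<phi>3 (\<phi>2 \<theta>)) \<and>
        \<phi>2 ` {\<theta>. \<phi> \<theta> \<le> c0} \<subset> - (\<phi>2 ` (- \<Theta>0)) \<and>
        emeasure lebesgue {p. p \<in> - (\<phi>2 ` (- \<Theta>0)) \<and> \<phi>3 p > c0} > 0 \<and>
        has_positive_pdf F2 \<and>
        posterior_prob_continuous Q \<phi>2 (- (\<phi>2 ` (- \<Theta>0))) \<longrightarrow>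
        (\<forall>\<theta>. \<phi> \<theta> = c0 \<longrightarrow> rejection_prob \<alpha> S Q \<Theta>0 \<theta> < \<alpha>))
     \<and>
     (\<forall>(S1 :: real ^ 'd \<Rightarrow> (real ^ 'd) measure) Q1 \<Theta>1 \<phi> c0 F2 \<theta>.
        bayes_test \<alpha> S1 Q1 \<Theta>1 \<and>
        support_point_at (closure (- \<Theta>1)) \<phi> c0 \<theta> \<and> - \<Theta>1 \<subseteq> {t. c0 \<le> \<phi> t} \<and>
        condition_A S1 Q1 \<phi> \<and> {t. \<phi> t \<le> c0} \<subset> \<Theta>1 \<and>
        location_model S1 Q1 (\<lambda>t. t) F2 \<and>
        emeasure lebesgue {p. p \<in> \<Theta>1 \<and> \<phi> p > c0} > 0 \<and>
        has_positive_pdf F2 \<and>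
        posterior_prob_continuous Q1 (\<lambda>t. t) \<Theta>1 \<longrightarrow>
        rejection_prob \<alpha> S1 Q1 \<Theta>1 \<theta> < \<alpha>)"
proof (intro conjI allI impI, goal_cases)
  case (1 \<phi> c0)
  then show ?case using half_space_size(2)[OF \<alpha>, of S Q \<phi> c0] test by simp
next
  case (2 \<phi> c0 \<theta>)
  then show ?case using half_space_size(1)[OF \<alpha>, of S Q \<phi> c0 \<theta>] test by simp
next
  case (3 \<phi> c0)
  then show ?case using size_ge_if_subset_half_space[OF \<alpha> test] by blast
next
  case (4 \<phi> c0 T F2 h \<theta>)
  then show ?case
    using rejection_prob_gt_on_hyperplane(1)[OF \<alpha> test, of \<phi> c0 T F2 h \<theta>] by blast
next
  case (5 \<phi> c0 T F2 h)
  then show ?case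
    using rejection_prob_gt_on_hyperplane(2)[OF \<alpha> test, of \<phi> c0 T F2 h] by blast
next
  case (6 S1 Q1 \<Theta>1 \<phi> c0 F2 \<theta>)
  then show ?case
    using rejection_prob_gt_on_hyperplane(1)[OF \<alpha>, of S1 Q1 \<Theta>1 \<phi> c0 "\<lambda>t. t" F2 \<phi> \<theta>]
    by (auto simp: support_point_at_def bounded_linear.linear)
next
  case 7
  show ?case using projected_size_one[OF \<alpha>(1) refl] \<alpha>(2) by (metis)
next
  case 8
  show ?case using sliced_half_plane_size[OF \<alpha>] by blast
next
  case 9
  show ?case using sliced_size_zero[OF \<alpha>] \<alpha>(1) by metis
next
  case 10
  show ?case using projected_size_one[OF \<alpha>(1) refl] sliced_size_zero[OF \<alpha>] by (metis zero_neq_one)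
next
  case (11 \<phi> c0 T F2 h \<theta>)
  then show ?case
    using rejection_prob_less_on_hyperplane[OF \<alpha> test, of \<phi> T F2 h c0 \<theta>] by blast
next
  case (12 S1 Q1 \<Theta>1 \<phi> c0 F2 \<theta>)
  then show ?case
    using rejection_prob_less_on_hyperplane[OF \<alpha>, of S1 Q1 \<Theta>1 \<phi> "\<lambda>t. t" F2 \<phi> c0 \<theta>]
    by (auto simp: support_point_at_def bounded_linear.linear)
qed

end
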